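(* Let $G$ be a $k$-subset of permutations in $\mathrm{Sym}(n)$ chosen uniformly at random from all such $k$-subsets. Then the typical (expected) number $c_i$ of non-trivial switches in row $i$ of a switch table for $G$, for $i=1,2,\dots,n$, is given by $$\mathbb{E}[c_i]=(n-i)\Bigl(1-\prod_{t=0}^{k-1}\Bigl(1-\frac{(n-i)!}{n!-t}\Bigr)\Bigr).$$ If $k$ is sufficiently smaller than $n!$, a binomial approximation of this is given as follows: let $G$ be a random sequence of $k$ permutations in $\mathrm{Sym}(n)$, each chosen uniformly and independently at random with replacement. Then the typical (expected) number $c_i$ of non-trivial switches in row $i$, for $i=1,2,\dots,n$, is given by $$\mathbb{E}[c_i]=(n-i)\Bigl(1-\Bigl(1-\frac{1}{(n)_i}\Bigr)^{k}\Bigr).$$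
   Context: For a set (or sequence) $G$ of permutations of $\{1,\dots,n\}$, the entry in row $i$ and column $j$ of a switch table for $G$ is non-trivial if and only if $j>i$ and there is a $\pi$ in $G$ with $\pi(t)=t$ for all $t<i$ and $\pi(j)=i$. Thus $c_i$ is the number of $j\in\{i+1,\dots,n\}$ for which such a $\pi$ exists. $(n)_i:=n(n-1)\cdots(n-i+1)$. *)

theory Defs
  imports "HOL-Probability.Probability" "HOL-Combinatorics.Permutations"
begin

definition Sym :: "nat \<Rightarrow> (nat \<Rightarrow> nat) set" where
  "Sym n = {\<pi>. \<pi> permutes {1..n}}"

definition nontrivial_switch :: "(nat \<Rightarrow> nat) set \<Rightarrow> nat \<Rightarrow> nat \<Rightarrow> bool" where
  "nontrivial_switch G i j \<longleftrightarrow> j > i \<and> (\<exists>\<pi>\<in>G. (\<forall>t\<in>{1..<i}. \<pi> t = t) \<and> \<pi> j = i)"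

definition switch_count :: "nat \<Rightarrow> (nat \<Rightarrow> nat) set \<Rightarrow> nat \<Rightarrow> nat" where
  "switch_count n G i = card {j \<in> {1..n}. nontrivial_switch G i j}"

definition random_subset :: "nat \<Rightarrow> nat \<Rightarrow> (nat \<Rightarrow> nat) set pmf" where
  "random_subset n k = pmf_of_set {G. G \<subseteq> Sym n \<and> card G = k}"

definition random_sequence :: "nat \<Rightarrow> nat \<Rightarrow> (nat \<Rightarrow> nat) list pmf" where
  "random_sequence n k = replicate_pmf k (pmf_of_set (Sym n))"

definition falling_factorial :: "nat \<Rightarrow> nat \<Rightarrow> nat" where
  "falling_factorial n i = (\<Prod>t<i. n - t)"

end

(* By linearity of expectation it suffices to find, for i < j, the probability that G meets the set
   of permutations that fix 1, ..., i - 1 and send j to i. Composing with the transposition of i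
   and j maps this set to the permutations of {i + 1, ..., n}, so it has (n - i)! elements whatever
   j is. A random k-subset misses m of N elements with probability C(N - m, k) / C(N, k), and k
   independent choices miss them with probability (1 - m / N)^k. *)
theory Submission
  imports Defs
begin

text \<open>Linearity of expectation: the cardinality is a sum of indicators, each bounded by 1 and
  so integrable for every \<open>p\<close>.\<close>

lemma expectation_card_filter:
  fixes p :: "'a pmf"
  assumes "finite J"
  shows "measure_pmf.expectation p (\<lambda>x. real (card {j \<in> J. Q x j})) =
    (\<Sum>j\<in>J. measure_pmf.prob p {x. Q x j})"
proof -
  have "real (card {j \<in> J. Q x j}) = (\<Sum>j\<in>J. indicator {x. Q x j} x)" for x
    using assms by (simp add: indicator_def sum.If_cases Int_def)
  moreover have "integrable (measure_pmf p) (indicator {x. Q x j} :: 'a \<Rightarrow> real)" for j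
    by (intro measure_pmf.integrable_const_bound[where B = 1]) (auto simp: indicator_def)
  ultimately show ?thesis
    by simp
qed

lemma prob_pair_pmf_Times:
  "measure_pmf.prob (pair_pmf p q) (A \<times> B) = measure_pmf.prob p A * measure_pmf.prob q B"
proof -
  \<comment> \<open>The product rule used below is for countable sets. Cutting \<open>A\<close> and
    \<open>B\<close> down to the supports makes them countable and changes the event only on a null
    set.\<close>
  have "measure_pmf.prob (pair_pmf p q) (A \<times> B) =
      measure_pmf.prob (pair_pmf p q) ((A \<inter> set_pmf p) \<times> (B \<inter> set_pmf q))"
    by (intro measure_pmf.finite_measure_eq_AE) (auto simp: AE_measure_pmf_iff)
  also have "\<dots> = measure_pmf.prob p (A \<inter> set_pmf p) * measure_pmf.prob q (B \<inter> set_pmf q)"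
    by (intro measure_pmf_prob_product) auto
  finally show ?thesis
    by (simp add: measure_Int_set_pmf)
qed

lemma prob_replicate_pmf_set_subset:
  "measure_pmf.prob (replicate_pmf k p) {xs. set xs \<subseteq> B} = measure_pmf.prob p B ^ k"
proof (induction k)
  case 0
  then show ?case by (simp add: measure_pmf_single)
next
  case (Suc k)
  \<comment> \<open>Written as the image of a pair of independent draws, the event pulls back along
    Cons to a rectangle, so the product rule applies.\<close>
  have "replicate_pmf (Suc k) p = map_pmf (\<lambda>(x, xs). x # xs) (pair_pmf p (replicate_pmf k p))"
    by (simp add: pair_pmf_def map_bind_pmf bind_return_pmf bind_assoc_pmf map_pmf_def)
  moreover have "(\<lambda>(x, xs). x # xs) -` {xs. set xs \<subseteq> B} = B \<times> {xs. set xs \<subseteq> B}"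
    by auto
  ultimately show ?case
    using Suc by (simp only: measure_map_pmf prob_pair_pmf_Times power_Suc)
qed

text \<open>Passing from \<open>k\<close> to \<open>Suc k\<close> multiplies the quotient by (N - m
  - k) / (N - k). If k > N - m, both sides vanish: the product then contains the zero factor t = N -
  m.\<close>

lemma binomial_diff_quotient:
  assumes "k \<le> N" and "m \<le> N"
  shows "real ((N - m) choose k) / real (N choose k) = (\<Prod>t<k. 1 - real m / (real N - real t))"
  using assms(1)
proof (induction k)
  case 0
  then show ?case by simp
next
  case (Suc k)
  \<comment> \<open>Needed for every \<open>a\<close>, since N - m may be smaller than
    \<open>k\<close>; in that case both binomial coefficients are 0 and the sign of a - k is
    harmless.\<close>
  have step: "real (a choose Suc k) = real (a choose k) * (real a - real k) / real (Suc k)" for a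
  proof (cases "k \<le> a")
    case True
    have "Suc k * (a choose Suc k) = (a choose k) * (a - k)"
      using binomial_absorb_comp[of a k] by (simp only: binomial_absorption mult.commute)
    then have "real (Suc k) * real (a choose Suc k) = real (a choose k) * (real a - real k)"
      using True by (metis of_nat_diff of_nat_mult)
    then show ?thesis
      by (simp add: field_simps del: of_nat_Suc)
  qed (simp add: binomial_eq_0)
  have "real ((N - m) choose Suc k) / real (N choose Suc k) =
      real ((N - m) choose k) / real (N choose k) * ((real N - real m - real k) / (real N - real k))"
    using assms(2) by (simp add: step of_nat_diff del: of_nat_Suc)
  also have "(real N - real m - real k) / (real N - real k) = 1 - real m / (real N - real k)"
    using Suc.prems by (simp add: field_simps)
  finally show ?case
    using Suc by simp
qed

lemma card_permutes_fixing_below: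
  assumes "i \<le> j" and "1 \<le> i" and "j \<le> n"
  shows "card {\<pi> \<in> Sym n. (\<forall>t\<in>{1..<i}. \<pi> t = t) \<and> \<pi> j = i} = fact (n - i)"
proof -
  let ?f = "\<lambda>\<pi>. \<pi> \<circ> Transposition.transpose i j"
  let ?A = "{\<pi> \<in> Sym n. (\<forall>t\<in>{1..<i}. \<pi> t = t) \<and> \<pi> j = i}"
  have "bij_betw ?f {\<rho>. \<rho> permutes {Suc i..n}} ?A"
  \<comment> \<open>A transposition is an involution, so precomposition with it is its own
    inverse.\<close>
  proof (rule bij_betw_byWitness[where f' = ?f])
    show "?f ` {\<rho>. \<rho> permutes {Suc i..n}} \<subseteq> ?A"
    proof clarify
      fix \<rho> assume \<rho>: "\<rho> permutes {Suc i..n}"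
      have "?f \<rho> permutes {1..n}"
        using assms by (intro permutes_compose permutes_swap_id permutes_subset[OF \<rho>]) auto
      moreover have "?f \<rho> t = t" if "t \<in> {1..<i}" for t
        using that assms permutes_not_in[OF \<rho>] by (simp add: Transposition.transpose_def)
      moreover have "?f \<rho> j = i"
        using permutes_not_in[OF \<rho>] by simp
      ultimately show "?f \<rho> \<in> Sym n \<and> (\<forall>t\<in>{1..<i}. ?f \<rho> t = t) \<and> ?f \<rho> j = i"
        by (simp add: Sym_def)
    qed
    show "?f ` ?A \<subseteq> {\<rho>. \<rho> permutes {Suc i..n}}"
    proof (rule image_subsetI)
      fix \<pi> assume "\<pi> \<in> ?A"
      then have \<pi>: "\<pi> permutes {1..n}" "\<forall>t\<in>{1..<i}. \<pi> t = t" "\<pi> j = i"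
        by (auto simp: Sym_def)
      have "?f \<pi> permutes {1..n}"
        using assms \<pi>(1) by (intro permutes_compose permutes_swap_id) auto
      \<comment> \<open>Points below i are fixed by the transposition and by \<open>\<pi>\<close>;
        the point i goes to j and then, by \<open>\<pi>\<close>, back to i.\<close>
      moreover have "?f \<pi> t = t" if "t \<in> {1..n} - {Suc i..n}" for t
      proof (cases "t = i")
        case False
        with that have "t \<in> {1..<i}"
          by auto
        moreover from this have "Transposition.transpose i j t = t"
          using assms(1) by (intro transpose_apply_other) auto
        ultimately show ?thesis
          using \<pi>(2) by simp
      qed (simp add: \<pi>(3))
      ultimately have "?f \<pi> permutes {Suc i..n}"
        by (rule permutes_superset)
      then show "?f \<pi> \<in> {\<rho>. \<rho> permutes {Suc i..n}}"
        by simp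
    qed
  qed (auto simp: comp_assoc)
  then show ?thesis
    using card_permutations[of "{Suc i..n}" "n - i"] by (simp add: bij_betw_same_card)
qed

lemma fact_eq_falling_factorial:
  assumes "i \<le> n"
  shows "fact n = falling_factorial n i * fact (n - i)"
  using assms
proof (induction i)
  case 0
  then show ?case by (simp add: falling_factorial_def)
next
  case (Suc i)
  then have "fact (n - i) = (n - i) * fact (n - Suc i)"
    by (metis Suc_diff_Suc Suc_le_lessD fact_Suc of_nat_id)
  with Suc show ?case
    by (simp add: falling_factorial_def algebra_simps)
qed

lemma finite_Sym: "finite (Sym n)" and card_Sym: "card (Sym n) = fact n"
  unfolding Sym_def using finite_permutations[of "{1..n}"] card_permutations[of "{1..n}" n]
  by simp_all

lemma prob_random_subset_disjoint:
  assumes "k \<le> fact n" and "A \<subseteq> Sym n"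
  shows "measure_pmf.prob (random_subset n k) {G. G \<inter> A = {}} =
    (\<Prod>t<k. 1 - real (card A) / (fact n - real t))"
proof -
  let ?S = "{G. G \<subseteq> Sym n \<and> card G = k}"
  have fin: "finite ?S"
    using finite_Sym by simp
  have card: "card ?S = fact n choose k"
    using n_subsets[OF finite_Sym] by (simp add: card_Sym)
  \<comment> \<open>\<open>pmf_of_set\<close> is uniform only on a nonempty finite set; k \<le> n!
    makes the binomial coefficient positive.\<close>
  then have ne: "?S \<noteq> {}"
    using assms(1) by (metis binomial_eq_0_iff card.empty leD)
  have "?S \<inter> {G. G \<inter> A = {}} = {G. G \<subseteq> Sym n - A \<and> card G = k}"
    by auto
  moreover have "card \<dots> = (fact n - card A) choose k"
    using n_subsets[of "Sym n - A" k] assms(2) finite_Sym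
    by (simp add: card_Sym card_Diff_subset finite_subset)
  moreover have "card A \<le> fact n"
    using card_mono[OF finite_Sym assms(2)] by (simp add: card_Sym)
  ultimately show ?thesis
    using binomial_diff_quotient[of k "fact n" "card A"] assms(1)
    by (simp add: random_subset_def measure_pmf_of_set[OF ne fin] card)
qed

lemma prob_random_sequence_disjoint:
  assumes "A \<subseteq> Sym n"
  shows "measure_pmf.prob (random_sequence n k) {xs. set xs \<inter> A = {}} =
    (1 - real (card A) / fact n) ^ k"
proof -
  have ne: "Sym n \<noteq> {}"
    using card_Sym[of n] by (metis card.empty fact_nonzero)
  have "measure_pmf.prob (pmf_of_set (Sym n)) A = real (card A) / fact n"
    using assms by (simp add: measure_pmf_of_set[OF ne finite_Sym] card_Sym Int_absorb1)
  moreover have "measure_pmf.prob (pmf_of_set (Sym n)) (- A) = 1 - measure_pmf.prob (pmf_of_set (Sym n)) A"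
    using measure_pmf.prob_compl[of A "pmf_of_set (Sym n)"] by (simp add: Compl_eq_Diff_UNIV)
  \<comment> \<open>Missing \<open>A\<close> means that every draw lands in the complement of
    \<open>A\<close>, an event that factors over the independent draws.\<close>
  moreover have "{xs. set xs \<inter> A = {}} = {xs. set xs \<subseteq> - A}"
    by auto
  ultimately show ?thesis
    by (simp add: random_sequence_def prob_replicate_pmf_set_subset)
qed

lemma set_pmf_random_subset:
  assumes "k \<le> fact n"
  shows "set_pmf (random_subset n k) = {G. G \<subseteq> Sym n \<and> card G = k}"
  unfolding random_subset_def
proof (rule set_pmf_of_set)
  show "finite {G. G \<subseteq> Sym n \<and> card G = k}"
    using finite_Sym by simp
  show "{G. G \<subseteq> Sym n \<and> card G = k} \<noteq> {}"
    using obtain_subset_with_card_n[of k "Sym n"] assms by (auto simp: card_Sym)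
qed

lemma set_pmf_random_sequence:
  "set_pmf (random_sequence n k) = {xs. set xs \<subseteq> Sym n \<and> length xs = k}"
proof -
  have "Sym n \<noteq> {}"
    using card_Sym[of n] by (metis card.empty fact_nonzero)
  then show ?thesis
    by (auto simp: random_sequence_def set_replicate_pmf finite_Sym lists_eq_set)
qed

text \<open>Treats both random models at once: \<open>f\<close> turns a sample into its set of
  permutations, and \<open>q\<close> is the chance of missing a given set of (n - i)! permutations.
  As \<open>q\<close> depends only on the size of that set, all n - i columns right of i contribute
  the same 1 - q.\<close>

lemma expectation_switch_count:
  fixes p :: "'a pmf" and f :: "'a \<Rightarrow> (nat \<Rightarrow> nat) set"
  assumes "1 \<le> i" and "i \<le> n"
    and sub: "\<And>x. x \<in> set_pmf p \<Longrightarrow> f x \<subseteq> Sym n"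
    and prob: "\<And>A. A \<subseteq> Sym n \<Longrightarrow> card A = fact (n - i) \<Longrightarrow>
      measure_pmf.prob p {x. f x \<inter> A = {}} = q"
  shows "measure_pmf.expectation p (\<lambda>x. real (switch_count n (f x) i)) = (real n - real i) * (1 - q)"
proof -
  have "measure_pmf.prob p {x. nontrivial_switch (f x) i j} = (if i < j then 1 - q else 0)"
    if "j \<in> {1..n}" for j
  proof (cases "i < j")
    case True
    let ?A = "{\<pi> \<in> Sym n. (\<forall>t\<in>{1..<i}. \<pi> t = t) \<and> \<pi> j = i}"
    \<comment> \<open>The two events agree only almost surely: \<open>?A\<close> demands membership
      in \<open>Sym n\<close>, which \<open>nontrivial_switch\<close> does not, but samples in the
      support consist of such permutations.\<close>
    have "measure_pmf.prob p {x. nontrivial_switch (f x) i j} =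
        measure_pmf.prob p (- {x. f x \<inter> ?A = {}})"
      using True sub by (intro measure_pmf.finite_measure_eq_AE)
        (auto simp: AE_measure_pmf_iff nontrivial_switch_def)
    also have "\<dots> = 1 - measure_pmf.prob p {x. f x \<inter> ?A = {}}"
      using measure_pmf.prob_compl[of "{x. f x \<inter> ?A = {}}" p] by (simp add: Compl_eq_Diff_UNIV)
    also have "\<dots> = 1 - q"
      using True that assms(1) card_permutes_fixing_below[of i j n] by (subst prob) auto
    finally show ?thesis
      using True by simp
  qed (simp add: nontrivial_switch_def)
  then have "(\<Sum>j\<in>{1..n}. measure_pmf.prob p {x. nontrivial_switch (f x) i j}) =
      (\<Sum>j\<in>{1..n}. if i < j then 1 - q else 0)"
    by (intro sum.cong) auto
  also have "\<dots> = (\<Sum>j\<in>{Suc i..n}. 1 - q)"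
    using assms(1) by (intro sum.mono_neutral_cong_right) auto
  also have "\<dots> = (real n - real i) * (1 - q)"
    using assms(2) by (simp add: of_nat_diff)
  finally show ?thesis
    by (simp only: switch_count_def expectation_card_filter[OF finite_atLeastAtMost])
qed

theorem theorem4:
  fixes n k i :: nat
  assumes "1 \<le> i" and "i \<le> n"
  shows "(k \<le> fact n \<longrightarrow>
      measure_pmf.expectation (random_subset n k) (\<lambda>G. real (switch_count n G i)) =
        (real n - real i) * (1 - (\<Prod>t<k. 1 - fact (n - i) / (fact n - real t)))) \<and>
    measure_pmf.expectation (random_sequence n k) (\<lambda>xs. real (switch_count n (set xs) i)) =
        (real n - real i) * (1 - (1 - 1 / real (falling_factorial n i)) ^ k)"
proof (intro conjI impI)
  assume "k \<le> fact n"
  then show "measure_pmf.expectation (random_subset n k) (\<lambda>G. real (switch_count n G i)) =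
      (real n - real i) * (1 - (\<Prod>t<k. 1 - fact (n - i) / (fact n - real t)))"
    using assms
    by (intro expectation_switch_count)
      (auto simp: set_pmf_random_subset prob_random_subset_disjoint)
next
  \<comment> \<open>The sequence model yields the ratio (n - i)! / n!; cancelling (n - i)! turns it
    into the reciprocal of the falling factorial.\<close>
  have "(fact n :: real) = real (falling_factorial n i) * fact (n - i)"
    using fact_eq_falling_factorial[OF assms(2)] by (metis of_nat_fact of_nat_mult)
  then have "fact (n - i) / (fact n :: real) = 1 / real (falling_factorial n i)"
    by simp
  then show "measure_pmf.expectation (random_sequence n k) (\<lambda>xs. real (switch_count n (set xs) i)) =
      (real n - real i) * (1 - (1 - 1 / real (falling_factorial n i)) ^ k)"
    using assms
    by (intro expectation_switch_count)
      (auto simp: set_pmf_random_sequence prob_random_sequence_disjoint)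
qed

end
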